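(* Let $n>3$ be an integer and let $FQ_n$ be the folded hypercube of dimension $n$. Then $\mathrm{Aut}(FQ_n)$ is a semidirect product of $N$ by $M$, where $N$ and $M$ are subgroups of $\mathrm{Aut}(FQ_n)$ such that $N$ is isomorphic to the Abelian group $\mathbb{Z}_2^n$ and $M$ is isomorphic to the symmetric group $\mathrm{Sym}(n+1)$.
   Context: Graphs are undirected. The hypercube $Q_n$ of dimension $n$ is the graph with vertex-set $\{(x_1,\dots,x_n) \mid x_i\in\{0,1\}\}$, in which two vertices $(x_1,\dots,x_n)$ and $(y_1,\dots,y_n)$ are adjacent if and only if $x_i=y_i$ for all but exactly one $i$. The folded hypercube $FQ_n$ is the graph obtained from $Q_n$ by adding an edge between every two vertices $(x_1,\dots,x_n)$ and $(\bar{x}_1,\dots,\bar{x}_n)$, where $\bar 1=0$ and $\bar 0=1$. Equivalently, $FQ_n$ is the Cayley graph of $\mathbb{Z}_2^n$ with connection set $S=\{e_1,\dots,e_n,\,e_1+\cdots+e_n\}$, where $e_i$ is the $i$-th standard basis vector: $v,w\in\mathbb{Z}_2^n$ are adjacent iff $w-v\in S$. $\mathrm{Aut}(\Gamma)$ denotes the group, under composition, of automorphisms of the graph $\Gamma$ (bijections $\alpha$ of the vertex-set such that $\{a,b\}$ is an edge iff $\{\alpha(a),\alpha(b)\}$ is an edge). $\mathrm{Sym}(m)$ is the symmetric group of degree $m$. A group $G$ is a semidirect product of $N$ by $Q$, written $G=N\rtimes Q$, if $G$ contains subgroups $N$ and $Q$ such that (i) $N\unlhd G$, (ii) $NQ=G$,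 and (iii) $N\cap Q=\{1\}$. *)

theory Defs
  imports
    "Graph_Theory.Pair_Digraph"
    "HOL-Algebra.Bij"
    "HOL-Algebra.Product_Groups"
    "HOL-Algebra.Sym_Groups"
begin

text \<open>
  An undirected simple graph is a \<^locale>\<open>pair_graph\<close>: each edge between \<open>u\<close> and \<open>v\<close> is
  represented by the two arcs \<open>(u, v)\<close> and \<open>(v, u)\<close>.
\<close>

definition cube_verts :: "nat \<Rightarrow> (nat \<Rightarrow> int) set" where
  "cube_verts n = {1..n} \<rightarrow>\<^sub>E {0, 1}"

definition hypercube :: "nat \<Rightarrow> (nat \<Rightarrow> int) pair_pre_digraph" where
  "hypercube n =
     \<lparr> pverts = cube_verts n,
       parcs = {(x, y). x \<in> cube_verts n \<and> y \<in> cube_verts n \<and> (\<exists>!i. i \<in> {1..n} \<and> x i \<noteq> y i)} \<rparr>"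

definition antipode :: "nat \<Rightarrow> (nat \<Rightarrow> int) \<Rightarrow> (nat \<Rightarrow> int)" where
  "antipode n x = (\<lambda>i\<in>{1..n}. 1 - x i)"

definition folded_hypercube :: "nat \<Rightarrow> (nat \<Rightarrow> int) pair_pre_digraph" where
  "folded_hypercube n =
     \<lparr> pverts = pverts (hypercube n),
       parcs = parcs (hypercube n) \<union> {(x, y). x \<in> pverts (hypercube n) \<and> y = antipode n x} \<rparr>"

text \<open>
  As for \<^const>\<open>AutoGroup\<close>, automorphisms are functions that are extensional on the vertex set, so
  that distinct elements are distinct as maps of vertices.
\<close>

definition graph_auto :: "'a pair_pre_digraph \<Rightarrow> ('a \<Rightarrow> 'a) set" where
  "graph_auto \<Gamma> = {f \<in> Bij (pverts \<Gamma>).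
     \<forall>a\<in>pverts \<Gamma>. \<forall>b\<in>pverts \<Gamma>. (a, b) \<in> parcs \<Gamma> \<longleftrightarrow> (f a, f b) \<in> parcs \<Gamma>}"

definition graph_Aut :: "'a pair_pre_digraph \<Rightarrow> ('a \<Rightarrow> 'a) monoid" where
  "graph_Aut \<Gamma> = BijGroup (pverts \<Gamma>) \<lparr>carrier := graph_auto \<Gamma>\<rparr>"

definition is_semidirect_product :: "('a, 'b) monoid_scheme \<Rightarrow> 'a set \<Rightarrow> 'a set \<Rightarrow> bool" where
  "is_semidirect_product G N Q \<longleftrightarrow>
     group G \<and> subgroup N G \<and> subgroup Q G \<and>
     N \<lhd> G \<and> N <#>\<^bsub>G\<^esub> Q = carrier G \<and> N \<inter> Q = {\<one>\<^bsub>G\<^esub>}"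

definition Z2_power :: "nat \<Rightarrow> (nat \<Rightarrow> int) monoid" where
  "Z2_power n = product_group {1..n} (\<lambda>_. integer_mod_group 2)"

lemma antipode_in_cube_verts: "x \<in> cube_verts n \<Longrightarrow> antipode n x \<in> cube_verts n"
  by (auto simp: cube_verts_def antipode_def PiE_iff)

lemma antipode_antipode: "x \<in> cube_verts n \<Longrightarrow> antipode n (antipode n x) = x"
  by (rule ext) (simp add: cube_verts_def antipode_def PiE_iff extensional_def)

lemma finite_cube_verts: "finite (cube_verts n)"
  by (simp add: cube_verts_def finite_PiE)

lemma pair_graph_folded_hypercube:
  assumes "n \<ge> 1"
  shows "pair_graph (folded_hypercube n)"
proof
  let ?G = "folded_hypercube n"
  show wf: "fst e \<in> pverts ?G" "snd e \<in> pverts ?G" if "e \<in> parcs ?G" for e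
    using that by (auto simp: folded_hypercube_def hypercube_def antipode_in_cube_verts)
  show fin: "finite (pverts ?G)"
    by (simp add: folded_hypercube_def hypercube_def finite_cube_verts)
  have "parcs ?G \<subseteq> pverts ?G \<times> pverts ?G"
    using wf by (auto simp: mem_Times_iff)
  then show "finite (parcs ?G)"
    using fin by (meson finite_SigmaI finite_subset)
  have ne: "antipode n x \<noteq> x" for x
  proof
    assume "antipode n x = x"
    then have "antipode n x 1 = x 1" by simp
    then show False using assms by (simp add: antipode_def) presburger
  qed
  show "fst e \<noteq> snd e" if "e \<in> parcs ?G" for e
  proof (cases e)
    case (Pair x y)
    then have "(\<exists>!i. i \<in> {1..n} \<and> x i \<noteq> y i) \<or> y = antipode n x"
      using that unfolding folded_hypercube_def hypercube_def by simp argo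
    then have "x \<noteq> y"
      using ne[of x] by auto
    with Pair show ?thesis by simp
  qed
  have "(y, x) \<in> parcs ?G" if "(x, y) \<in> parcs ?G" for x y
  proof (cases "y = antipode n x")
    case True
    have "x \<in> cube_verts n"
      using that by (auto simp: folded_hypercube_def hypercube_def)
    then show ?thesis
      using True
      by (simp add: folded_hypercube_def hypercube_def antipode_in_cube_verts antipode_antipode)
  next
    case False
    have "(\<lambda>i. i \<in> {1..n} \<and> y i \<noteq> x i) = (\<lambda>i. i \<in> {1..n} \<and> x i \<noteq> y i)"
      by (rule ext) auto
    then have "(\<exists>!i. i \<in> {1..n} \<and> y i \<noteq> x i) \<longleftrightarrow> (\<exists>!i. i \<in> {1..n} \<and> x i \<noteq> y i)"
      by (rule arg_cong[where f = Ex1])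
    then show ?thesis
      using that False by (simp add: folded_hypercube_def hypercube_def)
  qed
  then show "symmetric ?G"
    by (auto simp: symmetric_def sym_def)
qed

lemma subgroup_graph_auto: "subgroup (graph_auto \<Gamma>) (BijGroup (pverts \<Gamma>))"
proof (rule group.subgroupI[OF group_BijGroup])
  let ?V = "pverts \<Gamma>"
  show "graph_auto \<Gamma> \<subseteq> carrier (BijGroup ?V)"
    by (auto simp: graph_auto_def BijGroup_def)
  have "(\<lambda>x\<in>?V. x) \<in> graph_auto \<Gamma>"
    by (simp add: graph_auto_def id_Bij)
  then show "graph_auto \<Gamma> \<noteq> {}" by blast
  fix f assume f: "f \<in> graph_auto \<Gamma>"
  then have fB: "f \<in> Bij ?V" by (simp add: graph_auto_def)
  then have bij: "bij_betw f ?V ?V" by (simp add: Bij_def)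
  have inv: "inv_into ?V f a \<in> ?V" "f (inv_into ?V f a) = a" if "a \<in> ?V" for a
    using that bij fB by (auto simp: Bij_inv_into_mem bij_betw_inv_into_right)
  show "inv\<^bsub>BijGroup ?V\<^esub> f \<in> graph_auto \<Gamma>"
    using f inv by (auto simp: inv_BijGroup[OF fB] graph_auto_def restrict_inv_into_Bij)
  fix g assume g: "g \<in> graph_auto \<Gamma>"
  then have gB: "g \<in> Bij ?V" by (simp add: graph_auto_def)
  have "g a \<in> ?V" if "a \<in> ?V" for a
    using that Bij_imp_funcset[OF gB] by auto
  then show "f \<otimes>\<^bsub>BijGroup ?V\<^esub> g \<in> graph_auto \<Gamma>"
    using f g fB gB compose_Bij[OF fB gB]
    by (auto simp: BijGroup_def graph_auto_def compose_eq)
qed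

lemma group_graph_Aut: "group (graph_Aut \<Gamma>)"
  unfolding graph_Aut_def
  by (rule subgroup.subgroup_is_group[OF subgroup_graph_auto group_BijGroup])

end

theory Submission
  imports Defs
begin

text \<open>
  The folded hypercube is the Cayley graph of \<open>Z\<^sub>2\<^sup>n\<close> whose connection set \<open>S\<close> consists of the
  basis vectors \<open>e\<^sub>1, \<dots>, e\<^sub>n\<close> and their sum \<open>e\<^sub>n\<^sub>+\<^sub>1\<close>. The only linear relation between these
  \<open>n + 1\<close> vectors is that all of them sum to zero, so for \<open>n + 1 \<ge> 5\<close> no relation involves at
  most four of them. In other words \<open>S\<close> is a Sidon set: a sum of two distinct elements of \<open>S\<close>
  determines the two summands (lemma \<open>sidon_fold_gen\<close>). Graphically, the two ends of a path
  \<open>v, v + s, v + s + t\<close> with \<open>s \<noteq> t\<close> lie on exactly one common 4-cycle.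

  This makes the Cayley graph rigid. An automorphism \<open>f\<close> relabels the edges at each vertex \<open>v\<close> by
  some permutation of \<open>S\<close>; since \<open>f\<close> maps the 4-cycle on \<open>v, v + s, v + s + t, v + t\<close> to a
  4-cycle, whose opposite edges have equal labels, the permutations at \<open>v\<close> and \<open>v + s\<close> agree.
  As \<open>S\<close> generates the group, one permutation serves for all vertices, and so \<open>f\<close> is affine
  (\<open>affine_of_arc_preserving\<close>).

  Hence the translations form a normal subgroup, isomorphic to \<open>Z\<^sub>2\<^sup>n\<close>, and the stabilizer of zero
  is a complement that consists of linear maps permuting \<open>S\<close>
  (\<open>semidirect_translations_stabilizer\<close>). A linear map is determined by its values on \<open>S\<close>, and
  conversely every permutation of \<open>S\<close> extends to a linear map (\<open>permutation_extends\<close>), because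
  the single relation is symmetric in the elements of \<open>S\<close>. So the stabilizer is isomorphic to
  the symmetric group of degree \<open>n + 1\<close> (\<open>stabilizer_iso_sym_group\<close>).
\<close>

section \<open>Cayley graphs of elementary abelian 2-groups\<close>

definition cayley_graph :: "('a, 'b) monoid_scheme \<Rightarrow> 'a set \<Rightarrow> 'a pair_pre_digraph" where
  "cayley_graph G S =
     \<lparr> pverts = carrier G, parcs = {(x, y). x \<in> carrier G \<and> (\<exists>s\<in>S. y = x \<otimes>\<^bsub>G\<^esub> s)} \<rparr>"

text \<open>
  The last assumption says that \<open>S\<close> is a Sidon set; sums \<open>a \<otimes> a = \<one>\<close> must be exempted from
  unique representation, as they all coincide.
\<close>

locale sidon_cayley = comm_group G for G (structure) +
  fixes S
  assumes square: "x \<in> carrier G \<Longrightarrow> x \<otimes> x = \<one>"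
    and gens: "S \<subseteq> carrier G"
    and generates: "generate G S = carrier G"
    and sidon: "\<lbrakk>a \<in> S; b \<in> S; c \<in> S; d \<in> S; a \<noteq> b; a \<otimes> b = c \<otimes> d\<rbrakk> \<Longrightarrow> a = c \<or> a = d"
begin

lemma gen_closed [simp]: "s \<in> S \<Longrightarrow> s \<in> carrier G"
  using gens by blast

lemma square_left: "\<lbrakk>x \<in> carrier G; y \<in> carrier G\<rbrakk> \<Longrightarrow> x \<otimes> (x \<otimes> y) = y"
  by (metis l_one m_assoc square)

lemma inv_eq_self: "x \<in> carrier G \<Longrightarrow> inv x = x"
  using inv_equality square by blast

lemma hom_eq_on_gens:
  assumes "h \<in> hom G G" "k \<in> hom G G" "\<And>s. s \<in> S \<Longrightarrow> h s = k s" "x \<in> carrier G"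
  shows "h x = k x"
proof -
  have "x \<in> generate G S" using assms(4) generates by simp
  then show ?thesis
  proof induction
    case one
    then show ?case using assms(1,2) hom_one[OF _ is_group is_group] by metis
  next
    case (inv s)
    then show ?case using assms(3) by (simp add: inv_eq_self)
  next
    case (eng x y)
    then show ?case using assms(1,2) generates by (simp add: hom_mult)
  qed (rule assms(3))
qed

text \<open>
  The label that \<open>f\<close> gives to an edge \<open>{x, x \<otimes> t}\<close> is \<open>f x \<otimes> f (x \<otimes> t)\<close>, the element of \<open>S\<close> by
  which the end points of the image differ. The lemma compares the labels of two parallel edges
  in direction \<open>t\<close>. The four vertices \<open>v, v \<otimes> s, v \<otimes> s \<otimes> t, v \<otimes> t\<close> are mapped to a 4-cycle with
  labels \<open>a, b, d, c\<close>. The two ways around it give \<open>a \<otimes> b = c \<otimes> d\<close>, and injectivity of \<open>f\<close>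
  excludes \<open>a = b\<close> and \<open>a = c\<close>; the Sidon property then leaves only \<open>a = d\<close> and \<open>b = c\<close>.
\<close>

lemma parallel_edges_same_label:
  assumes inj: "inj_on f (carrier G)" and clo: "f \<in> carrier G \<rightarrow> carrier G"
    and arc: "\<And>x s. \<lbrakk>x \<in> carrier G; s \<in> S\<rbrakk> \<Longrightarrow> \<exists>t\<in>S. f (x \<otimes> s) = f x \<otimes> t"
    and v: "v \<in> carrier G" and s: "s \<in> S" and t: "t \<in> S"
  shows "f (v \<otimes> s) \<otimes> f (v \<otimes> s \<otimes> t) = f v \<otimes> f (v \<otimes> t)"
proof (cases "s = t")
  case True
  then have "v \<otimes> s \<otimes> t = v" using v s by (simp add: m_assoc square)
  moreover have "f v \<in> carrier G" "f (v \<otimes> s) \<in> carrier G" using clo v s by auto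
  ultimately show ?thesis using True by (simp add: m_comm)
next
  case False
  obtain a where a: "a \<in> S" "f (v \<otimes> s) = f v \<otimes> a" using arc v s by blast
  obtain b where b: "b \<in> S" "f (v \<otimes> s \<otimes> t) = f (v \<otimes> s) \<otimes> b" using arc v s t by (meson gen_closed m_closed)
  obtain c where c: "c \<in> S" "f (v \<otimes> t) = f v \<otimes> c" using arc v t by blast
  obtain d where d: "d \<in> S" "f (v \<otimes> t \<otimes> s) = f (v \<otimes> t) \<otimes> d" using arc v s t by (meson gen_closed m_closed)
  have fv: "f v \<in> carrier G" using clo v by auto
  have comm: "v \<otimes> t \<otimes> s = v \<otimes> s \<otimes> t" using v s t by (simp add: m_ac)
  have "f v \<otimes> (a \<otimes> b) = f v \<otimes> (c \<otimes> d)"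
    using a b c d comm fv by (simp add: m_assoc)
  then have abcd: "a \<otimes> b = c \<otimes> d" using a b c d fv by simp
  have "a \<noteq> c"
  proof
    assume "a = c"
    then have "f (v \<otimes> s) = f (v \<otimes> t)" using a c by simp
    then have "v \<otimes> s = v \<otimes> t" using inj v s t by (simp add: inj_on_eq_iff)
    then show False using False v s t by simp
  qed
  moreover have "a \<noteq> b"
  proof
    assume "a = b"
    then have "f (v \<otimes> s \<otimes> t) = f v" using a b fv by (simp add: m_assoc square)
    then have "v \<otimes> s \<otimes> t = v" using inj v s t by (simp add: inj_on_eq_iff)
    then have "s \<otimes> t = \<one>" using v s t by (simp add: m_assoc)
    then have "s \<otimes> t = s \<otimes> s" using s by (simp add: square)
    then show False using False s t by simp
  qed
  ultimately have "a = d" using sidon[OF a(1) b(1) c(1) d(1)] abcd by blast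
  then have "a \<otimes> b = a \<otimes> c" using abcd c d by (simp add: m_comm)
  then have "b = c" using a b c by simp
  then show ?thesis
    using b c fv clo v s by (simp add: square_left Pi_iff)
qed

text \<open>
  Edge labels are invariant under translation by each generator, hence by every group element.
  So \<open>f (v \<otimes> t)\<close> differs from \<open>f v\<close> by the label that \<open>t\<close> has at \<open>\<one>\<close>, and writing \<open>y\<close> as a
  product of generators extends this from \<open>t\<close> to \<open>y\<close>. The factor \<open>f \<one>\<close> is its own inverse: it
  corrects for the translation part of \<open>f\<close>.
\<close>

theorem affine_of_arc_preserving:
  assumes inj: "inj_on f (carrier G)" and clo: "f \<in> carrier G \<rightarrow> carrier G"
    and arc: "\<And>x s. \<lbrakk>x \<in> carrier G; s \<in> S\<rbrakk> \<Longrightarrow> \<exists>t\<in>S. f (x \<otimes> s) = f x \<otimes> t"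
    and x: "x \<in> carrier G" and y: "y \<in> carrier G"
  shows "f (x \<otimes> y) = f x \<otimes> f \<one> \<otimes> f y"
proof -
  have fc [simp]: "f z \<in> carrier G" if "z \<in> carrier G" for z using clo that by auto
  note sq = parallel_edges_same_label[OF inj clo arc]
  have shift: "f (v \<otimes> u) \<otimes> f (v \<otimes> u \<otimes> t) = f v \<otimes> f (v \<otimes> t)"
    if "u \<in> generate G S" "v \<in> carrier G" "t \<in> S" for u v t
    using that
  proof (induction arbitrary: v t)
    case (inv s)
    then show ?case using sq by (simp add: inv_eq_self)
  next
    case (eng u w)
    then have "u \<in> carrier G" "w \<in> carrier G" using generates by auto
    then show ?case using eng.IH(1)[of v t] eng.IH(2)[of "v \<otimes> u" t] eng.prems
      by (simp add: m_assoc)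
  qed (simp_all add: sq)
  have step: "f (v \<otimes> t) = f v \<otimes> f \<one> \<otimes> f t" if "v \<in> carrier G" "t \<in> S" for v t
  proof -
    have "f v \<otimes> f (v \<otimes> t) = f \<one> \<otimes> f t"
      using shift[of v \<one> t] that generates by simp
    then have "f v \<otimes> (f v \<otimes> f (v \<otimes> t)) = f v \<otimes> (f \<one> \<otimes> f t)" by simp
    then show ?thesis using that by (simp add: square_left m_assoc)
  qed
  have "y \<in> generate G S" using y generates by simp
  then show ?thesis using x
  proof (induction arbitrary: x)
    case one
    then show ?case by (simp add: m_assoc square)
  next
    case (inv s)
    then show ?case using step by (simp add: inv_eq_self)
  next
    case (eng u w)
    then have "u \<in> carrier G" "w \<in> carrier G" using generates by auto
    then show ?case using eng.IH(1)[of x] eng.IH(2)[of "x \<otimes> u"] eng.IH(2)[of u] eng.prems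
      by (simp add: m_assoc[symmetric])
  qed (rule step)
qed

section \<open>The automorphism group as a semidirect product\<close>

abbreviation "Cay \<equiv> cayley_graph G S"

abbreviation "A \<equiv> graph_Aut Cay"

lemma auto_iff:
  "f \<in> graph_auto Cay \<longleftrightarrow> f \<in> Bij (carrier G) \<and>
     (\<forall>x\<in>carrier G. \<forall>y\<in>carrier G. (\<exists>s\<in>S. y = x \<otimes> s) \<longleftrightarrow> (\<exists>s\<in>S. f y = f x \<otimes> s))"
proof -
  have "f x \<in> carrier G" if "f \<in> Bij (carrier G)" "x \<in> carrier G" for x
    using that Bij_imp_funcset by blast
  then show ?thesis
    unfolding graph_auto_def cayley_graph_def by simp blast
qed

lemma auto_arc:
  assumes f: "f \<in> graph_auto Cay" and x: "x \<in> carrier G" and s: "s \<in> S"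
  shows "\<exists>t\<in>S. f (x \<otimes> s) = f x \<otimes> t"
proof -
  have "x \<otimes> s \<in> carrier G" using x s by simp
  then have "(\<exists>t\<in>S. x \<otimes> s = x \<otimes> t) \<longleftrightarrow> (\<exists>t\<in>S. f (x \<otimes> s) = f x \<otimes> t)"
    using f x unfolding auto_iff by blast
  then show ?thesis using s by blast
qed

lemma auto_affine:
  assumes "f \<in> graph_auto Cay" "x \<in> carrier G" "y \<in> carrier G"
  shows "f (x \<otimes> y) = f x \<otimes> f \<one> \<otimes> f y"
proof (rule affine_of_arc_preserving[OF _ _ _ assms(2,3)])
  have B: "f \<in> Bij (carrier G)" using assms(1) auto_iff by blast
  then show "inj_on f (carrier G)" by (simp add: Bij_def bij_betw_def)
  show "f \<in> carrier G \<rightarrow> carrier G" using B by (rule Bij_imp_funcset)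
  show "\<exists>t\<in>S. f (x \<otimes> s) = f x \<otimes> t" if "x \<in> carrier G" "s \<in> S" for x s
    using auto_arc[OF assms(1) that] .
qed

lemma Aut_simps:
  "carrier A = graph_auto Cay"
  "\<one>\<^bsub>A\<^esub> = (\<lambda>x\<in>carrier G. x)"
  "\<lbrakk>f \<in> graph_auto Cay; g \<in> graph_auto Cay\<rbrakk> \<Longrightarrow> f \<otimes>\<^bsub>A\<^esub> g = compose (carrier G) f g"
  by (auto simp: graph_Aut_def BijGroup_def graph_auto_def cayley_graph_def)

definition translation :: "'a \<Rightarrow> 'a \<Rightarrow> 'a" where
  "translation a = (\<lambda>x\<in>carrier G. a \<otimes> x)"

definition stabilizer :: "('a \<Rightarrow> 'a) set" where
  "stabilizer = {f \<in> graph_auto Cay. f \<one> = \<one>}"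

lemma translation_auto:
  assumes a: "a \<in> carrier G"
  shows "translation a \<in> graph_auto Cay"
proof -
  have "bij_betw (translation a) (carrier G) (carrier G)"
    by (rule bij_betw_byWitness[where f' = "translation a"])
       (use a in \<open>auto simp: translation_def square_left\<close>)
  then show ?thesis using a
    by (auto simp: auto_iff Bij_def translation_def m_assoc)
qed

lemma translation_compose:
  assumes "a \<in> carrier G" "b \<in> carrier G"
  shows "translation a \<otimes>\<^bsub>A\<^esub> translation b = translation (a \<otimes> b)"
  using assms
  by (simp add: Aut_simps translation_auto compose_def) (auto simp: translation_def m_assoc)

lemma translation_group_hom: "group_hom G A translation"
  by (auto simp: group_hom_def group_hom_axioms_def hom_def is_group group_graph_Aut
      Aut_simps(1) translation_auto translation_compose)

lemma inj_translation: "inj_on translation (carrier G)"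
proof (rule inj_onI)
  fix a b assume ab: "a \<in> carrier G" "b \<in> carrier G" "translation a = translation b"
  then have "translation a \<one> = translation b \<one>" by simp
  then show "a = b" using ab by (simp add: translation_def)
qed

lemma subgroup_translations: "subgroup (translation ` carrier G) A"
  by (rule group_hom.img_is_subgroup[OF translation_group_hom])

lemma translations_iso: "A\<lparr>carrier := translation ` carrier G\<rparr> \<cong> G"
proof -
  have "translation \<in> iso G (A\<lparr>carrier := translation ` carrier G\<rparr>)"
    by (auto simp: iso_def hom_def translation_compose bij_betw_def inj_translation)
  then show ?thesis
    using iso_sym is_isoI by blast
qed

lemma auto_closed: "\<lbrakk>f \<in> graph_auto Cay; x \<in> carrier G\<rbrakk> \<Longrightarrow> f x \<in> carrier G"
  using auto_iff Bij_imp_funcset by blast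

text \<open>
  Affinity is what makes this subgroup normal: \<open>f (a \<otimes> x) = (f \<one> \<otimes> f a) \<otimes> f x\<close> says that
  conjugation by \<open>f\<close> turns the translation by \<open>a\<close> into the translation by \<open>f \<one> \<otimes> f a\<close>.
\<close>

lemma normal_translations: "translation ` carrier G \<lhd> A"
proof -
  interpret A: group A by (rule group_graph_Aut)
  have "f \<otimes>\<^bsub>A\<^esub> translation a \<otimes>\<^bsub>A\<^esub> inv\<^bsub>A\<^esub> f = translation (f \<one> \<otimes> f a)"
    if f: "f \<in> graph_auto Cay" and a: "a \<in> carrier G" for f a
  proof -
    have c: "f a \<in> carrier G" "f \<one> \<in> carrier G" using f a by (auto simp: auto_closed)
    have "f \<otimes>\<^bsub>A\<^esub> translation a = translation (f \<one> \<otimes> f a) \<otimes>\<^bsub>A\<^esub> f"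
      using f a c
      by (simp add: Aut_simps translation_auto compose_def)
        (auto simp: translation_def auto_affine auto_closed m_ac intro!: restrict_ext)
    moreover have "f \<in> carrier A" "translation (f \<one> \<otimes> f a) \<in> carrier A"
      using f c by (simp_all add: Aut_simps(1) translation_auto)
    ultimately show ?thesis by (simp add: A.m_assoc)
  qed
  then show ?thesis
    by (auto simp: A.normal_inv_iff subgroup_translations Aut_simps(1) auto_closed)
qed

lemma subgroup_stabilizer: "subgroup stabilizer A"
proof -
  interpret A: group A by (rule group_graph_Aut)
  show ?thesis
  proof (rule A.subgroupI)
    show "stabilizer \<subseteq> carrier A" by (auto simp: stabilizer_def Aut_simps(1))
    show "stabilizer \<noteq> {}"
      using A.one_closed unfolding stabilizer_def Aut_simps(1,2) by fastforce
    fix f assume f: "f \<in> stabilizer"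
    then have fA: "f \<in> graph_auto Cay" "f \<one> = \<one>" by (auto simp: stabilizer_def)
    let ?g = "inv\<^bsub>A\<^esub> f"
    have g: "?g \<in> graph_auto Cay" using A.inv_closed fA by (simp add: Aut_simps(1))
    have "(?g \<otimes>\<^bsub>A\<^esub> f) \<one> = \<one>" using fA by (simp add: Aut_simps(1,2))
    then show "?g \<in> stabilizer" using fA g by (simp add: Aut_simps compose_eq stabilizer_def)
    fix g assume "g \<in> stabilizer"
    then show "f \<otimes>\<^bsub>A\<^esub> g \<in> stabilizer" using f A.m_closed[of f g]
      by (auto simp: stabilizer_def Aut_simps compose_eq)
  qed
qed

theorem semidirect_translations_stabilizer:
  "is_semidirect_product A (translation ` carrier G) stabilizer"
proof -
  interpret A: group A by (rule group_graph_Aut)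
  have "f \<in> translation ` carrier G <#>\<^bsub>A\<^esub> stabilizer" if f: "f \<in> graph_auto Cay" for f
  proof -
    \<comment> \<open>Translations are involutions, so translating \<open>f\<close> by \<open>f \<one>\<close> moves the image of \<open>\<one>\<close> back to \<open>\<one>\<close>.\<close>
    define g where "g = translation (f \<one>) \<otimes>\<^bsub>A\<^esub> f"
    have c: "f \<one> \<in> carrier G" using f by (simp add: auto_closed)
    have gA: "g \<in> graph_auto Cay"
      using A.m_closed[of "translation (f \<one>)" f] f c by (simp add: g_def Aut_simps(1) translation_auto)
    have "g \<one> = \<one>"
      using f c
      by (simp add: g_def Aut_simps translation_auto compose_eq) (simp add: translation_def square)
    then have "g \<in> stabilizer" using gA by (simp add: stabilizer_def)
    moreover have "f = translation (f \<one>) \<otimes>\<^bsub>A\<^esub> g"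
    proof -
      have "translation (f \<one>) \<otimes>\<^bsub>A\<^esub> g = translation \<one> \<otimes>\<^bsub>A\<^esub> f"
        using f c by (simp add: g_def A.m_assoc[symmetric] Aut_simps(1) translation_auto
            translation_compose square)
      moreover have "translation \<one> = \<one>\<^bsub>A\<^esub>"
        using group_hom.hom_one[OF translation_group_hom] .
      ultimately show ?thesis using f by (simp add: Aut_simps(1))
    qed
    ultimately show ?thesis using c unfolding set_mult_def by blast
  qed
  moreover have "translation ` carrier G <#>\<^bsub>A\<^esub> stabilizer \<subseteq> carrier A"
    using A.set_mult_closed subgroup_translations subgroup_stabilizer by (simp add: subgroup.subset)
  ultimately have product: "translation ` carrier G <#>\<^bsub>A\<^esub> stabilizer = carrier A"
    by (auto simp: Aut_simps(1))
  have "translation ` carrier G \<inter> stabilizer = {\<one>\<^bsub>A\<^esub>}"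
  proof -
    have "a = \<one>" if "a \<in> carrier G" "translation a \<in> stabilizer" for a
      using that by (simp add: stabilizer_def translation_def)
    then have "translation ` carrier G \<inter> stabilizer \<subseteq> {\<one>\<^bsub>A\<^esub>}"
      using group_hom.hom_one[OF translation_group_hom] by auto
    then show ?thesis
      using subgroup.one_closed[OF subgroup_translations] subgroup.one_closed[OF subgroup_stabilizer]
      by blast
  qed
  with product show ?thesis
    unfolding is_semidirect_product_def
    by (simp add: group_graph_Aut subgroup_translations subgroup_stabilizer normal_translations)
qed

lemma stabilizer_hom: "f \<in> stabilizer \<Longrightarrow> f \<in> hom G G"
  by (auto simp: stabilizer_def hom_def auto_closed auto_affine)

lemma stabilizer_gens:
  assumes f: "f \<in> stabilizer" and s: "s \<in> S"
  shows "f s \<in> S"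
proof -
  have fA: "f \<in> graph_auto Cay" "f \<one> = \<one>" using f by (auto simp: stabilizer_def)
  obtain t where "t \<in> S" "f (\<one> \<otimes> s) = f \<one> \<otimes> t"
    using auto_arc[OF fA(1) one_closed s] by blast
  then show ?thesis using fA(2) s by simp
qed

lemma stabilizerI:
  assumes h: "h \<in> hom G G" "bij_betw h (carrier G) (carrier G)" "h \<in> extensional (carrier G)"
    and S: "h ` S = S"
  shows "h \<in> stabilizer"
proof -
  have "(\<exists>s\<in>S. y = x \<otimes> s) \<longleftrightarrow> (\<exists>s\<in>S. h y = h x \<otimes> s)"
    if xy: "x \<in> carrier G" "y \<in> carrier G" for x y
  proof
    assume "\<exists>s\<in>S. y = x \<otimes> s"
    then obtain s where s: "s \<in> S" "y = x \<otimes> s" by blast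
    then have "h s \<in> S" "h y = h x \<otimes> h s" using xy S h(1) by (auto simp: hom_mult)
    then show "\<exists>s\<in>S. h y = h x \<otimes> s" by blast
  next
    assume "\<exists>s\<in>S. h y = h x \<otimes> s"
    then obtain t where t: "t \<in> S" "h y = h x \<otimes> t" by blast
    from t(1) have "t \<in> h ` S" by (simp only: S)
    then obtain s where s: "s \<in> S" "h y = h x \<otimes> h s" using t(2) by blast
    then have "h y = h (x \<otimes> s)" using xy h(1) by (simp add: hom_mult)
    then have "y = x \<otimes> s" 
      using h(2) xy s by (meson bij_betw_imp_inj_on gen_closed inj_onD m_closed)
    then show "\<exists>s\<in>S. y = x \<otimes> s" using s by blast
  qed
  moreover have "h \<one> = \<one>" using h(1) hom_one is_group by blast
  ultimately show ?thesis using h by (simp add: stabilizer_def auto_iff Bij_def)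
qed

text \<open>
  The isomorphism is the action on \<open>S\<close>, read through the numbering \<open>s\<close>. It is faithful because
  \<open>S\<close> generates \<open>G\<close>. For surjectivity it suffices that every permutation of \<open>S\<close> extends to an
  endomorphism: the extensions of a permutation and of its inverse compose to a map that is the
  identity on \<open>S\<close>, hence everywhere, so both are bijective.
\<close>

theorem stabilizer_iso_sym_group:
  assumes s: "bij_betw s {1..m} S"
    and ext: "\<And>p. p permutes {1..m} \<Longrightarrow> \<exists>h\<in>hom G G. \<forall>i\<in>{1..m}. h (s i) = s (p i)"
  shows "A\<lparr>carrier := stabilizer\<rparr> \<cong> sym_group m"
proof -
  define r where "r = inv_into {1..m} s"
  have rs: "r (s i) = i" if "i \<in> {1..m}" for i
    using s that by (simp add: r_def bij_betw_inv_into_left)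
  have sr: "s (r x) = x" "r x \<in> {1..m}" if "x \<in> S" for x
    using s that bij_betwE[OF bij_betw_inv_into[OF s]] by (auto simp: r_def bij_betw_inv_into_right)
  have sS: "s i \<in> S" if "i \<in> {1..m}" for i using s that by (auto simp: bij_betw_def)
  define \<Psi> where "\<Psi> f = (\<lambda>i. if i \<in> {1..m} then r (f (s i)) else i)" for f
  have s\<Psi>: "s (\<Psi> f i) = f (s i)" "\<Psi> f i \<in> {1..m}" if "f \<in> stabilizer" "i \<in> {1..m}" for f i
    using that by (auto simp: \<Psi>_def sr stabilizer_gens sS simp del: atLeastAtMost_iff One_nat_def)
  have perm: "\<Psi> f permutes {1..m}" if f: "f \<in> stabilizer" for f
  proof -
    have "inj_on f S" using f gens
      by (auto simp: stabilizer_def auto_iff Bij_def bij_betw_def intro: inj_on_subset)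
    then have "inj_on (\<Psi> f) {1..m}"
      using s\<Psi>[OF f] rs sS by (metis (no_types, lifting) inj_on_def)
    moreover have "\<Psi> f ` {1..m} \<subseteq> {1..m}" using s\<Psi>[OF f] by blast
    ultimately have "\<Psi> f ` {1..m} = {1..m}" by (intro endo_inj_surj) auto
    then show ?thesis using \<open>inj_on (\<Psi> f) {1..m}\<close>
      by (intro bij_imp_permutes) (auto simp: bij_betw_def \<Psi>_def)
  qed
  have mult: "\<Psi> (f \<otimes>\<^bsub>A\<^esub> g) = \<Psi> f \<circ> \<Psi> g" if fg: "f \<in> stabilizer" "g \<in> stabilizer" for f g
  proof
    fix i
    have "f \<in> graph_auto Cay" "g \<in> graph_auto Cay" using fg by (auto simp: stabilizer_def)
    then show "\<Psi> (f \<otimes>\<^bsub>A\<^esub> g) i = (\<Psi> f \<circ> \<Psi> g) i"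
      using s\<Psi>[OF fg(2), of i] sS[of i] by (auto simp: \<Psi>_def Aut_simps compose_eq)
  qed
  have inj: "inj_on \<Psi> stabilizer"
  proof (rule inj_onI)
    fix f g assume fg: "f \<in> stabilizer" "g \<in> stabilizer" and eq: "\<Psi> f = \<Psi> g"
    have "f x = g x" if "x \<in> S" for x
      using s\<Psi>(1)[OF fg(1), of "r x"] s\<Psi>(1)[OF fg(2), of "r x"] sr[OF that] eq by simp
    then have "f x = g x" if "x \<in> carrier G" for x
      using hom_eq_on_gens[OF stabilizer_hom[OF fg(1)] stabilizer_hom[OF fg(2)]] that by blast
    moreover have "f \<in> extensional (carrier G)" "g \<in> extensional (carrier G)"
      using fg by (auto simp: stabilizer_def auto_iff Bij_def)
    ultimately show "f = g" by (metis extensionalityI)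
  qed
  have surj: "\<exists>f\<in>stabilizer. \<Psi> f = p" if p: "p permutes {1..m}" for p
  proof -
    obtain h where h: "h \<in> hom G G" "\<And>i. i \<in> {1..m} \<Longrightarrow> h (s i) = s (p i)"
      using ext[OF p] by blast
    obtain k where k: "k \<in> hom G G" "\<And>i. i \<in> {1..m} \<Longrightarrow> k (s i) = s (inv_into UNIV p i)"
      using ext[OF permutes_inv[OF p]] by blast
    have pin: "p i \<in> {1..m}" "inv_into UNIV p i \<in> {1..m}" if "i \<in> {1..m}" for i
      using that permutes_in_image[OF p] permutes_in_image[OF permutes_inv[OF p]] by auto
    have hS: "h x \<in> S" "k x \<in> S" "k (h x) = x" "h (k x) = x" if x: "x \<in> S" for x
    proof -
      obtain i where i: "i \<in> {1..m}" "x = s i" using sr[OF x] by metis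
      show "h x \<in> S" "k x \<in> S" "k (h x) = x" "h (k x) = x"
        using i pin h(2) k(2) sS permutes_inverses[OF p] by auto
    qed
    have id: "id \<in> hom G G" by (simp add: hom_def)
    have kh: "k (h x) = x" and hk: "h (k x) = x" if x: "x \<in> carrier G" for x
    proof -
      have "compose (carrier G) k h x = id x"
        by (rule hom_eq_on_gens[OF hom_compose[OF h(1) k(1)] id _ x]) (simp add: compose_eq hS)
      then show "k (h x) = x" using x by (simp add: compose_eq)
      have "compose (carrier G) h k x = id x"
        by (rule hom_eq_on_gens[OF hom_compose[OF k(1) h(1)] id _ x]) (simp add: compose_eq hS)
      then show "h (k x) = x" using x by (simp add: compose_eq)
    qed
    let ?f = "restrict h (carrier G)"
    have "?f \<in> stabilizer"
    proof (rule stabilizerI)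
      show "?f \<in> hom G G" using h(1) by (auto simp: hom_def)
      have "bij_betw h (carrier G) (carrier G)"
        using h(1) k(1) kh hk by (intro bij_betw_byWitness[where f' = k]) (auto simp: hom_def)
      then show "bij_betw ?f (carrier G) (carrier G)" by simp
      have "h ` S = S" using hS by force
      then show "?f ` S = S" using gens by (simp add: image_restrict_eq Int_absorb1)
    qed simp
    moreover have "\<Psi> ?f = p"
    proof
      fix i
      show "\<Psi> ?f i = p i"
      proof (cases "i \<in> {1..m}")
        case True
        then have "s i \<in> carrier G" using sS gens by blast
        then have "\<Psi> ?f i = r (h (s i))" using True by (simp add: \<Psi>_def)
        also have "\<dots> = p i" using h(2)[OF True] rs[OF pin(1)[OF True]] by simp
        finally show ?thesis .
      next
        case False
        then have "\<Psi> ?f i = i" unfolding \<Psi>_def by (rule if_not_P)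
        then show ?thesis using permutes_not_in[OF p False] by simp
      qed
    qed
    ultimately show ?thesis by blast
  qed
  have "bij_betw \<Psi> stabilizer (carrier (sym_group m))"
    unfolding bij_betw_def
  proof
    show "\<Psi> ` stabilizer = carrier (sym_group m)"
    proof
      show "\<Psi> ` stabilizer \<subseteq> carrier (sym_group m)"
        using perm sym_group_carrier by blast
      show "carrier (sym_group m) \<subseteq> \<Psi> ` stabilizer"
        using surj sym_group_carrier by blast
    qed
  qed (rule inj)
  then have "\<Psi> \<in> iso (A\<lparr>carrier := stabilizer\<rparr>) (sym_group m)"
    unfolding iso_def hom_def using perm mult by (simp add: sym_group_carrier sym_group_mult Pi_iff)
  then show ?thesis by (rule is_isoI)
qed

end

section \<open>The folded hypercube as a Cayley graph\<close>

text \<open>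
  For \<open>i \<le> n\<close> this is the basis vector \<open>e\<^sub>i\<close>; the extra index \<open>n + 1\<close> stands for the all-ones vector
  \<open>e\<^sub>1 + \<dots> + e\<^sub>n\<close>, which produces the edges between antipodes.
\<close>

definition fold_gen :: "nat \<Rightarrow> nat \<Rightarrow> nat \<Rightarrow> int" where
  "fold_gen n i = (\<lambda>j\<in>{1..n}. if j = i \<or> i = n + 1 then 1 else 0)"

lemma carrier_Z2_power: "carrier (Z2_power n) = cube_verts n"
proof -
  have "{0..<2} = {0, 1 :: int}" by auto
  then show ?thesis by (simp add: Z2_power_def cube_verts_def carrier_integer_mod_group)
qed

lemma mult_Z2_power: "x \<otimes>\<^bsub>Z2_power n\<^esub> y = (\<lambda>i\<in>{1..n}. (x i + y i) mod 2)"
  by (simp add: Z2_power_def)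

lemma one_Z2_power: "\<one>\<^bsub>Z2_power n\<^esub> = (\<lambda>i\<in>{1..n}. 0)"
  by (simp add: Z2_power_def)

lemma comm_group_Z2_power: "comm_group (Z2_power n)"
proof -
  have "group (Z2_power n)" by (simp add: Z2_power_def)
  then show ?thesis
    by (rule group.group_comm_groupI) (simp add: mult_Z2_power add.commute)
qed

lemma fold_gen_in: "fold_gen n i \<in> cube_verts n"
  by (auto simp: fold_gen_def cube_verts_def)

lemma cube_vert_cases: "x \<in> cube_verts n \<Longrightarrow> i \<in> {1..n} \<Longrightarrow> x i = 0 \<or> x i = 1"
  by (auto simp: cube_verts_def PiE_iff)

lemma cube_vert_eqI:
  "\<lbrakk>x \<in> cube_verts n; y \<in> cube_verts n; \<And>i. i \<in> {1..n} \<Longrightarrow> x i = y i\<rbrakk> \<Longrightarrow> x = y"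
  unfolding cube_verts_def by (rule PiE_ext)

lemma mult_in_cube_verts: "x \<otimes>\<^bsub>Z2_power n\<^esub> y \<in> cube_verts n"
  by (auto simp: mult_Z2_power cube_verts_def)

lemma antipode_eq:
  assumes "x \<in> cube_verts n"
  shows "antipode n x = x \<otimes>\<^bsub>Z2_power n\<^esub> fold_gen n (n + 1)"
proof (rule cube_vert_eqI[OF antipode_in_cube_verts[OF assms] mult_in_cube_verts])
  fix i assume "i \<in> {1..n}"
  then show "antipode n x i = (x \<otimes>\<^bsub>Z2_power n\<^esub> fold_gen n (n + 1)) i"
    using cube_vert_cases[OF assms, of i] by (auto simp: antipode_def mult_Z2_power fold_gen_def)
qed

lemma hypercube_arc_iff:
  assumes x: "x \<in> cube_verts n" and y: "y \<in> cube_verts n"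
  shows "(\<exists>!i. i \<in> {1..n} \<and> x i \<noteq> y i) \<longleftrightarrow> (\<exists>i\<in>{1..n}. y = x \<otimes>\<^bsub>Z2_power n\<^esub> fold_gen n i)"
proof
  assume "\<exists>!i. i \<in> {1..n} \<and> x i \<noteq> y i"
  then obtain i where ii: "i \<in> {1..n} \<and> x i \<noteq> y i"
    and uu: "\<forall>j. j \<in> {1..n} \<and> x j \<noteq> y j \<longrightarrow> j = i"
    by (rule ex1E) (rule that)
  note i = conjunct1[OF ii] conjunct2[OF ii]
  have u: "x j = y j" if "j \<in> {1..n}" "j \<noteq> i" for j using uu that by blast
  have "y = x \<otimes>\<^bsub>Z2_power n\<^esub> fold_gen n i"
  proof (rule cube_vert_eqI[OF y mult_in_cube_verts])
    fix j assume j: "j \<in> {1..n}"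
    then show "y j = (x \<otimes>\<^bsub>Z2_power n\<^esub> fold_gen n i) j"
      using i u[OF j] cube_vert_cases[OF x j] cube_vert_cases[OF y j]
      by (cases "j = i") (auto simp: mult_Z2_power fold_gen_def)
  qed
  then show "\<exists>i\<in>{1..n}. y = x \<otimes>\<^bsub>Z2_power n\<^esub> fold_gen n i" using i by blast
next
  assume "\<exists>i\<in>{1..n}. y = x \<otimes>\<^bsub>Z2_power n\<^esub> fold_gen n i"
  then obtain i where i: "i \<in> {1..n}" and y: "y = x \<otimes>\<^bsub>Z2_power n\<^esub> fold_gen n i" by blast
  have "x j \<noteq> y j \<longleftrightarrow> j = i" if "j \<in> {1..n}" for j
    using i that cube_vert_cases[OF x that] by (auto simp: y mult_Z2_power fold_gen_def)
  then show "\<exists>!i. i \<in> {1..n} \<and> x i \<noteq> y i" using i by blast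
qed

lemma folded_hypercube_eq_cayley:
  "folded_hypercube n = cayley_graph (Z2_power n) (fold_gen n ` {1..n + 1})"
proof -
  let ?C = "cayley_graph (Z2_power n) (fold_gen n ` {1..n + 1})"
  have "(x, y) \<in> parcs (folded_hypercube n) \<longleftrightarrow> (x, y) \<in> parcs ?C" for x y
  proof -
    have idx: "{1..n + 1} = insert (n + 1) {1..n}" by auto
    have "(x, y) \<in> parcs (folded_hypercube n) \<longleftrightarrow> x \<in> cube_verts n \<and>
        (y \<in> cube_verts n \<and> (\<exists>!i. i \<in> {1..n} \<and> x i \<noteq> y i) \<or> y = antipode n x)"
      unfolding folded_hypercube_def hypercube_def by simp argo
    also have "\<dots> \<longleftrightarrow> x \<in> cube_verts n \<and>
        ((\<exists>i\<in>{1..n}. y = x \<otimes>\<^bsub>Z2_power n\<^esub> fold_gen n i) \<or>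
          y = x \<otimes>\<^bsub>Z2_power n\<^esub> fold_gen n (n + 1))"
    proof (cases "x \<in> cube_verts n")
      case x: True
      have "y \<in> cube_verts n \<and> (\<exists>!i. i \<in> {1..n} \<and> x i \<noteq> y i) \<longleftrightarrow>
          (\<exists>i\<in>{1..n}. y = x \<otimes>\<^bsub>Z2_power n\<^esub> fold_gen n i)"
      proof (cases "y \<in> cube_verts n")
        case True
        then show ?thesis using hypercube_arc_iff[OF x] by (simp only: simp_thms)
      next
        case False
        then show ?thesis using mult_in_cube_verts by blast
      qed
      then show ?thesis by (simp only: antipode_eq[OF x])
    qed (simp only: simp_thms)
    finally show ?thesis
      unfolding cayley_graph_def carrier_Z2_power idx by simp blast
  qed
  then have "parcs (folded_hypercube n) = parcs ?C" by (intro subset_antisym subrelI) blast+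
  moreover have "pverts (folded_hypercube n) = pverts ?C"
    by (simp add: cayley_graph_def carrier_Z2_power folded_hypercube_def hypercube_def)
  ultimately show ?thesis by simp
qed

text \<open>Already the basis vectors generate, by induction on the support of a 0-1 vector.\<close>

lemma generate_fold_gen: "generate (Z2_power n) (fold_gen n ` {1..n + 1}) = cube_verts n"
proof -
  let ?G = "Z2_power n" and ?S = "fold_gen n ` {1..n + 1}"
  interpret G: comm_group ?G by (rule comm_group_Z2_power)
  have incl: "generate ?G ?S \<subseteq> cube_verts n"
    using G.generate_incl[of ?S] fold_gen_in by (auto simp: carrier_Z2_power)
  have support: "(\<lambda>j\<in>{1..n}. if j \<in> T then 1 else 0) \<in> generate ?G ?S"
    if "finite T" "T \<subseteq> {1..n}" for T
    using that
  proof (induction T)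
    case empty
    then show ?case using generate.one[of ?G ?S] by (simp add: one_Z2_power del: restrict_apply)
  next
    case (insert i T)
    have "(\<lambda>j\<in>{1..n}. if j \<in> insert i T then 1 else 0) =
        fold_gen n i \<otimes>\<^bsub>?G\<^esub> (\<lambda>j\<in>{1..n}. if j \<in> T then 1 else 0)"
      using insert.hyps insert.prems by (auto simp: mult_Z2_power fold_gen_def intro!: restrict_ext)
    moreover have "fold_gen n i \<in> generate ?G ?S"
      using insert.prems by (intro generate.incl) auto
    moreover have "(\<lambda>j\<in>{1..n}. if j \<in> T then 1 else 0) \<in> generate ?G ?S"
      using insert by blast
    ultimately show ?case by (metis generate.eng)
  qed
  have "x \<in> generate ?G ?S" if "x \<in> cube_verts n" for x
  proof -
    have "x = (\<lambda>j\<in>{1..n}. if j \<in> {i \<in> {1..n}. x i = 1} then 1 else 0)"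
      by (rule cube_vert_eqI[OF that]) (use cube_vert_cases[OF that] in \<open>auto simp: cube_verts_def\<close>)
    also have "\<dots> \<in> generate ?G ?S" by (rule support) auto
    finally show ?thesis .
  qed
  then show ?thesis using incl by blast
qed

text \<open>
  Let \<open>u j\<close> count the occurrences of \<open>j\<close> among the four indices. Coordinate \<open>j \<le> n\<close> of the sum of
  the four vectors is \<open>u j + u (n + 1)\<close> modulo 2, so the equation says that \<open>u\<close> has constant parity
  on \<open>{1..n + 1}\<close>. There are at least five indices, so some index does not occur and the
  parity is even. Hence \<open>a\<close> occurs a second time. For \<open>n = 3\<close> the four generators sum to zero and
  the statement fails.
\<close>

lemma sidon_fold_gen:
  assumes n: "n > 3" and idx: "{a, b, c, d} \<subseteq> {1..n + 1}" and ab: "a \<noteq> b"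
    and eq: "fold_gen n a \<otimes>\<^bsub>Z2_power n\<^esub> fold_gen n b = fold_gen n c \<otimes>\<^bsub>Z2_power n\<^esub> fold_gen n d"
  shows "a = c \<or> a = d"
proof -
  define u :: "nat \<Rightarrow> int" where
    "u j = of_bool (j = a) + of_bool (j = b) + of_bool (j = c) + of_bool (j = d)" for j
  have const: "u j mod 2 = u (n + 1) mod 2" if j: "j \<in> {1..n + 1}" for j
  proof (cases "j = n + 1")
    case False
    with j have j: "j \<in> {1..n}" by auto
    have bits: "fold_gen n i j = of_bool (j = i) + of_bool (n + 1 = i)" for i
      using j by (auto simp: fold_gen_def)
    have eq_bits: "(fold_gen n a j + fold_gen n b j) mod 2 = (fold_gen n c j + fold_gen n d j) mod 2"
      using arg_cong[OF eq, of "\<lambda>x. x j"] j by (simp add: mult_Z2_power)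
    have mod2_iff: "v mod 2 = w mod 2 \<longleftrightarrow> (even v \<longleftrightarrow> even w)" for v w :: int
      by presburger
    have "(p1 + p2 + p3 + p4) mod 2 = (q1 + q2 + q3 + q4) mod 2"
      if "((p1 + q1) + (p2 + q2)) mod 2 = ((p3 + q3) + (p4 + q4)) mod 2"
      for p1 p2 p3 p4 q1 q2 q3 q4 :: int
      using that unfolding mod2_iff even_add by argo
    from this[OF eq_bits[unfolded bits]] show ?thesis unfolding u_def .
  qed simp
  have "\<not> {1..n + 1} \<subseteq> {a, b, c, d}"
  proof
    assume "{1..n + 1} \<subseteq> {a, b, c, d}"
    then have "card {1..n + 1} \<le> card {a, b, c, d}" by (intro card_mono) auto
    also have "\<dots> \<le> 4" using card_length[of "[a, b, c, d]"] by simp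
    finally show False using n by simp
  qed
  then obtain k where k: "k \<in> {1..n + 1}" "k \<notin> {a, b, c, d}" by blast
  have "u k = 0" using k(2) by (simp add: u_def)
  then have "u a mod 2 = 0" using const[OF k(1)] const[of a] idx by simp
  moreover have "u a = 1" if "a \<noteq> c" "a \<noteq> d" using that ab by (simp add: u_def)
  ultimately show ?thesis by fastforce
qed

text \<open>
  Two equal generators would sum to zero, as does any third one with itself; this is again a
  relation that the Sidon property forbids.
\<close>

lemma inj_fold_gen:
  assumes n: "n > 3"
  shows "inj_on (fold_gen n) {1..n + 1}"
proof (rule inj_onI)
  fix a b assume ab: "a \<in> {1..n + 1}" "b \<in> {1..n + 1}" and eq: "fold_gen n a = fold_gen n b"
  show "a = b"
  proof (rule ccontr)
    assume ne: "a \<noteq> b"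
    have "\<exists>c\<in>{1..n+1}. c \<noteq> a" using n by (intro bexI[of _ "if a = 1 then 2 else 1"]) auto
    then obtain c where c: "c \<in> {1..n+1}" "c \<noteq> a" by blast
    have "fold_gen n a \<otimes>\<^bsub>Z2_power n\<^esub> fold_gen n b = fold_gen n c \<otimes>\<^bsub>Z2_power n\<^esub> fold_gen n c"
      by (simp add: eq mult_Z2_power)
    then show False using sidon_fold_gen[OF n _ ne, of c c] ab c by auto
  qed
qed

text \<open>
  View \<open>Z\<^sub>2\<^sup>n\<close> as \<open>Z\<^sub>2\<^sup>n\<^sup>+\<^sup>1\<close> modulo the all-ones vector, with the vectors that vanish at \<open>n + 1\<close> as
  representatives. Then \<open>fold_gen n i\<close> is the class of the \<open>i\<close>-th basis vector for every
  \<open>i \<le> n + 1\<close>, and \<open>p\<close> acts by permuting all \<open>n + 1\<close> coordinates. In the proof, \<open>l\<close> selects the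
  representative; adding the coordinate at \<open>q (n + 1)\<close> to all others renormalizes the result so
  that it vanishes at \<open>n + 1\<close>.
\<close>

lemma permutation_extends:
  assumes p: "p permutes {1..n + 1}"
  shows "\<exists>h\<in>hom (Z2_power n) (Z2_power n). \<forall>i\<in>{1..n + 1}. h (fold_gen n i) = fold_gen n (p i)"
proof -
  define q where "q = inv_into UNIV p"
  define l where "l x i = (if i = n + 1 then 0 else x i)" for x :: "nat \<Rightarrow> int" and i
  define h where "h x = (\<lambda>j\<in>{1..n}. (l x (q j) + l x (q (n + 1))) mod 2)" for x
  have q_in: "q j \<in> {1..n + 1}" if "j \<in> {1..n + 1}" for j
    using that permutes_in_image[OF permutes_inv[OF p]] by (simp add: q_def)
  have q_eq: "q j = i \<longleftrightarrow> j = p i" for i j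
    using permutes_inverses[OF p] by (metis q_def)
  have l_mult: "l (x \<otimes>\<^bsub>Z2_power n\<^esub> y) i = (l x i + l y i) mod 2" if "i \<in> {1..n + 1}" for x y i
    using that by (auto simp: l_def mult_Z2_power)
  have l_gen: "(l (fold_gen n i) j + l (fold_gen n i) k) mod 2 = (of_bool (j = i) + of_bool (k = i)) mod 2"
    if "i \<in> {1..n + 1}" "j \<in> {1..n + 1}" "k \<in> {1..n + 1}" for i j k
    using that by (auto simp: l_def fold_gen_def)
  have "h \<in> hom (Z2_power n) (Z2_power n)"
  proof (rule homI)
    show "h x \<in> carrier (Z2_power n)" for x
      by (auto simp: h_def carrier_Z2_power cube_verts_def)
    show "h (x \<otimes>\<^bsub>Z2_power n\<^esub> y) = h x \<otimes>\<^bsub>Z2_power n\<^esub> h y" for x y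
    proof -
      have swap: "((a + b) mod 2 + (c + d) mod 2) mod 2 = ((a + c) mod 2 + (b + d) mod 2) mod 2"
        for a b c d :: int
        unfolding mod_add_eq by (simp add: ac_simps)
      have "h (x \<otimes>\<^bsub>Z2_power n\<^esub> y) =
        (\<lambda>j\<in>{1..n}. ((l x (q j) + l y (q j)) mod 2 + (l x (q (n + 1)) + l y (q (n + 1))) mod 2) mod 2)"
        unfolding h_def using q_in by (intro restrict_ext) (simp add: l_mult)
      also have "\<dots> = h x \<otimes>\<^bsub>Z2_power n\<^esub> h y"
        unfolding mult_Z2_power h_def by (intro restrict_ext) (simp only: restrict_apply' swap)
      finally show ?thesis .
    qed
  qed
  moreover have "h (fold_gen n i) = fold_gen n (p i)" if i: "i \<in> {1..n + 1}" for i
  proof -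
    have "h (fold_gen n i) = (\<lambda>j\<in>{1..n}. (of_bool (q j = i) + of_bool (q (n + 1) = i)) mod 2)"
      unfolding h_def using q_in i by (intro restrict_ext l_gen) auto
    also have "\<dots> = fold_gen n (p i)"
      unfolding fold_gen_def q_eq by (auto intro!: restrict_ext)
    finally show ?thesis .
  qed
  ultimately show ?thesis by blast
qed

lemma sidon_cayley_folded_hypercube:
  assumes n: "n > 3"
  shows "sidon_cayley (Z2_power n) (fold_gen n ` {1..n + 1})"
proof -
  interpret comm_group "Z2_power n" by (rule comm_group_Z2_power)
  show ?thesis
  proof
    show "x \<otimes>\<^bsub>Z2_power n\<^esub> x = \<one>\<^bsub>Z2_power n\<^esub>" for x
      by (simp add: mult_Z2_power one_Z2_power)
    show "fold_gen n ` {1..n + 1} \<subseteq> carrier (Z2_power n)"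
      using fold_gen_in by (auto simp: carrier_Z2_power)
    show "generate (Z2_power n) (fold_gen n ` {1..n + 1}) = carrier (Z2_power n)"
      by (simp only: generate_fold_gen carrier_Z2_power)
  next
    fix x y z w
    assume "x \<in> fold_gen n ` {1..n + 1}" "y \<in> fold_gen n ` {1..n + 1}"
      "z \<in> fold_gen n ` {1..n + 1}" "w \<in> fold_gen n ` {1..n + 1}"
      and ne: "x \<noteq> y" and eq: "x \<otimes>\<^bsub>Z2_power n\<^esub> y = z \<otimes>\<^bsub>Z2_power n\<^esub> w"
    then obtain a b c d where abcd: "{a, b, c, d} \<subseteq> {1..n + 1}"
      "x = fold_gen n a" "y = fold_gen n b" "z = fold_gen n c" "w = fold_gen n d"
      by (elim imageE) blast
    with ne have "a \<noteq> b" by blast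
    then show "x = z \<or> x = w"
      using sidon_fold_gen[OF n abcd(1)] eq abcd by blast
  qed
qed

theorem theorem2p4:
  fixes n :: nat
  assumes "n > 3"
  shows "\<exists>N M. is_semidirect_product (graph_Aut (folded_hypercube n)) N M \<and>
    (graph_Aut (folded_hypercube n))\<lparr>carrier := N\<rparr> \<cong> Z2_power n \<and>
    (graph_Aut (folded_hypercube n))\<lparr>carrier := M\<rparr> \<cong> sym_group (n + 1)"
proof -
  interpret sidon_cayley "Z2_power n" "fold_gen n ` {1..n + 1}"
    by (rule sidon_cayley_folded_hypercube[OF assms])
  have "bij_betw (fold_gen n) {1..n + 1} (fold_gen n ` {1..n + 1})"
    using inj_fold_gen[OF assms] by (simp add: bij_betw_def)
  then show ?thesis
    unfolding folded_hypercube_eq_cayley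
    using semidirect_translations_stabilizer translations_iso
      stabilizer_iso_sym_group[OF _ permutation_extends]
    by (intro exI conjI)
qed

end
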